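(* Let $C$ be a class variable with finite sample space $\mathbb{C}$ and let $X_1,\dots,X_p$ be categorical features with finite sample spaces $\mathbb{X}_1,\dots,\mathbb{X}_p$. Every naive staged tree classifier for the class $C$ and features $(X_1,\dots,X_p)$ has the same number of free parameters as the naive Bayes classifier for $C$ and $(X_1,\dots,X_p)$, namely $$|\mathbb{C}|-1+\sum_{j=1}^{p}|\mathbb{C}|\,(|\mathbb{X}_j|-1).$$
   Context: All variables are categorical with finite sample spaces having at least two elements, and $p\ge 1$. Write $\mathbb{X}_{[i]}=\mathbb{X}_1\times\cdots\times\mathbb{X}_i$. A $(C,\bm{X})$-compatible staged tree (a staged tree classifier) $T=(V,E,\theta)$ consists of the rooted directed tree whose vertices are the root $v_0$ and all tuples $(c,x_1,\dots,x_i)\in\mathbb{C}\times\mathbb{X}_{[i]}$ with $0\le i\le p$; whose edges are $(v_0,c)$ for $c\in\mathbb{C}$ and $((c,x_1,\dots,x_{i-1}),(c,x_1,\dots,x_i))$ for $1\le i\le p$; and a labelling $\theta$ of the edges induced by a colouring $\kappa:V\to\mathcal{L}$ ($\mathcal{L}$ a set of labels): $\theta(v_0,c)=(\kappa(v_0),c)$ and $\theta(v,(c,x_1,\dots,x_i))=(\kappa(v),x_i)$ for $v=(c,x_1,\dots,x_{i-1})$. Let $V_k$ be the set of vertices at distance $k$ from the root, so $V_k=\mathbb{C}\times\mathbb{X}_{[k-1]}$ for $1\le k\le p$ (with $V_1=\mathbb{C}$); the edges leaving vertices of $V_k$ correspond to values of $X_k$. The sample spaces of different variables are regarded as disjoint.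 Let $E(v)$ be the set of edges leaving $v$. Two internal vertices $v,w$ are in the same stage if $\theta(E(v))=\theta(E(w))$; equivalently, $v,w$ are at the same distance from the root and $\kappa(v)=\kappa(w)$. The stages partition the internal vertices. The parameter space of $T$ is $$\Theta_T=\Big\{y\in\mathbb{R}^{\theta(E)} : y_{\theta(e)}\in(0,1)\ \forall e\in E,\ \sum_{e\in E(v)}y_{\theta(e)}=1 \text{ for every internal vertex } v\Big\}.$$ The number of free parameters of $T$ is the dimension of $\Theta_T$, i.e. the sum over all stages of (number of edges leaving a vertex of the stage) $-1$. The staged tree classifier is called naive if, for every $1\le k\le p$, the set $V_k$ is partitioned into exactly $|\mathbb{C}|$ stages. The naive Bayes classifier is the model of joint mass functions factorizing as $P(c,x_1,\dots,x_p)=P(c)\prod_{k=1}^pP(x_k\mid c)$; its number of free parameters is the number of independent parameters in the probability tables $P(c)$ and $P(x_k\mid c)$. *)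

theory Defs
  imports "HOL-Analysis.Analysis" "HOL-Analysis.Finite_Function_Topology"
begin

section \<open>Dimension of a parameter space\<close>

text \<open>
  \<open>'e \<Rightarrow>\<^sub>0 real\<close> is a real vector space for an arbitrary type \<open>'e\<close>, and for a finite set
  \<open>I\<close> its subspace of all \<open>y\<close> with \<open>keys y \<subseteq> I\<close> is \<open>\<real>\<^sup>I\<close>.
  The dimension of a subset of it is the dimension of its affine hull, that is, of the
  linear span of the differences of its points. The library's \<open>aff_dim\<close> is restricted to the
  class \<open>euclidean_space\<close>, to which this type does not belong.
\<close>

definition affine_dimension :: "'v::real_vector set \<Rightarrow> nat" where
  "affine_dimension S = dim {x - y | x y. x \<in> S \<and> y \<in> S}"

section \<open>Staged trees\<close>

record ('v, 'l) staged_tree =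
  root_vertex :: 'v
  vertices :: "'v set"
  edges :: "('v \<times> 'v) set"
  label :: "'v \<times> 'v \<Rightarrow> 'l"

definition out_edges :: "('v, 'l) staged_tree \<Rightarrow> 'v \<Rightarrow> ('v \<times> 'v) set" where
  "out_edges T v = {e \<in> edges T. fst e = v}"

definition internal_vertices :: "('v, 'l) staged_tree \<Rightarrow> 'v set" where
  "internal_vertices T = {v \<in> vertices T. out_edges T v \<noteq> {}}"

text \<open>In a rooted tree directed away from the root, distance is the length of a directed walk.\<close>

definition level :: "('v, 'l) staged_tree \<Rightarrow> nat \<Rightarrow> 'v set" where
  "level T k = {v \<in> vertices T. (root_vertex T, v) \<in> edges T ^^ k}"

definition same_stage :: "('v, 'l) staged_tree \<Rightarrow> ('v \<times> 'v) set" where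
  "same_stage T = {(v, w). v \<in> internal_vertices T \<and> w \<in> internal_vertices T \<and>
     label T ` out_edges T v = label T ` out_edges T w}"

definition parameter_space :: "('v, 'l) staged_tree \<Rightarrow> ('l \<Rightarrow>\<^sub>0 real) set" where
  "parameter_space T = {y. Poly_Mapping.keys y \<subseteq> label T ` edges T \<and>
     (\<forall>e \<in> edges T. Poly_Mapping.lookup y (label T e) \<in> {0<..<1}) \<and>
     (\<forall>v \<in> internal_vertices T. (\<Sum>e \<in> out_edges T v. Poly_Mapping.lookup y (label T e)) = 1)}"

definition staged_tree_free_parameters :: "('v, 'l) staged_tree \<Rightarrow> nat" where
  "staged_tree_free_parameters T = affine_dimension (parameter_space T)"

section \<open>Staged tree classifiers\<close>

text \<open>
  \<open>C\<close> and \<open>X 1, \<dots>, X p\<close> are the sample spaces of the class and of the features.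
  The root is the empty list and \<open>(c, x\<^sub>1, \<dots>, x\<^sub>i)\<close> is the list \<open>[c, x\<^sub>1, \<dots>, x\<^sub>i]\<close>.
\<close>

definition feature_tuples :: "(nat \<Rightarrow> 'a set) \<Rightarrow> nat \<Rightarrow> 'a list set" where
  "feature_tuples X i = listset (map X [1..<Suc i])"

definition classifier_vertices :: "'a set \<Rightarrow> (nat \<Rightarrow> 'a set) \<Rightarrow> nat \<Rightarrow> 'a list set" where
  "classifier_vertices C X p =
     {[]} \<union> {c # xs | c xs i. c \<in> C \<and> i \<le> p \<and> xs \<in> feature_tuples X i}"

definition classifier_edges ::
    "'a set \<Rightarrow> (nat \<Rightarrow> 'a set) \<Rightarrow> nat \<Rightarrow> ('a list \<times> 'a list) set" where
  "classifier_edges C X p =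
     {([], [c]) | c. c \<in> C} \<union>
     {(c # xs, c # xs @ [x]) | c xs x i.
        c \<in> C \<and> i \<in> {1..p} \<and> xs \<in> feature_tuples X (i - 1) \<and> x \<in> X i}"

definition compatible_staged_tree ::
    "'a set \<Rightarrow> (nat \<Rightarrow> 'a set) \<Rightarrow> nat \<Rightarrow> ('a list, 'l \<times> 'a) staged_tree \<Rightarrow> bool" where
  "compatible_staged_tree C X p T \<longleftrightarrow>
     root_vertex T = [] \<and>
     vertices T = classifier_vertices C X p \<and>
     edges T = classifier_edges C X p \<and>
     (\<exists>\<kappa> :: 'a list \<Rightarrow> 'l. \<forall>v x. (v, v @ [x]) \<in> edges T \<longrightarrow> label T (v, v @ [x]) = (\<kappa> v, x))"

definition naive_staged_tree :: "'a set \<Rightarrow> nat \<Rightarrow> ('v, 'l) staged_tree \<Rightarrow> bool" where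
  "naive_staged_tree C p T \<longleftrightarrow> (\<forall>k \<in> {1..p}. card (level T k // same_stage T) = card C)"

section \<open>The naive Bayes classifier\<close>

text \<open>
  The entries of the probability tables: \<open>Class_Prob c\<close> is the entry \<open>P(c)\<close>, and
  \<open>Feature_Prob k c x\<close> is the entry \<open>P(X\<^sub>k = x | c)\<close>.
\<close>

datatype 'a table_entry = Class_Prob 'a | Feature_Prob nat 'a 'a

definition naive_bayes_entries ::
    "'a set \<Rightarrow> (nat \<Rightarrow> 'a set) \<Rightarrow> nat \<Rightarrow> 'a table_entry set" where
  "naive_bayes_entries C X p =
     Class_Prob ` C \<union> {Feature_Prob k c x | k c x. k \<in> {1..p} \<and> c \<in> C \<and> x \<in> X k}"

definition naive_bayes_tables ::
    "'a set \<Rightarrow> (nat \<Rightarrow> 'a set) \<Rightarrow> nat \<Rightarrow> ('a table_entry \<Rightarrow>\<^sub>0 real) set" where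
  "naive_bayes_tables C X p = {P. Poly_Mapping.keys P \<subseteq> naive_bayes_entries C X p \<and>
     (\<forall>e \<in> naive_bayes_entries C X p. 0 \<le> Poly_Mapping.lookup P e) \<and>
     (\<Sum>c \<in> C. Poly_Mapping.lookup P (Class_Prob c)) = 1 \<and>
     (\<forall>k \<in> {1..p}. \<forall>c \<in> C. (\<Sum>x \<in> X k. Poly_Mapping.lookup P (Feature_Prob k c x)) = 1)}"

text \<open>
  The number of independent entries of these tables. A table determines the joint mass function
  \<open>P(c, x\<^sub>1, \<dots>, x\<^sub>p) = P(c) \<cdot> P(x\<^sub>1 | c) \<cdots> P(x\<^sub>p | c)\<close> of the naive Bayes classifier.
\<close>

definition naive_bayes_free_parameters :: "'a set \<Rightarrow> (nat \<Rightarrow> 'a set) \<Rightarrow> nat \<Rightarrow> nat" where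
  "naive_bayes_free_parameters C X p = affine_dimension (naive_bayes_tables C X p)"

end

theory Submission
  imports Defs
begin

text \<open>
  Both parameter spaces are, up to closure, products of simplices over a partition of the
  coordinates: the blocks are the sets of edge labels of the stages for the tree, and the rows of
  the probability tables for naive Bayes. A block of size \<open>n\<close> contributes \<open>n - 1\<close> to the dimension.
  Stages of a tree do not share labels, because a label determines the feature (the sample spaces
  are disjoint) and the colour. Naivety gives the tree as many blocks of size \<open>card (X k)\<close> as there
  are rows \<open>P(X\<^sub>k | c)\<close>.
\<close>

section \<open>Dimension of a product of simplices\<close>

lemma lookup_scaleR [simp]:
  "Poly_Mapping.lookup (r *\<^sub>R y) x = r *\<^sub>R Poly_Mapping.lookup y x"
proof -
  \<comment> \<open>Finite support lets the coordinates of the scaled function be read off its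
    definition.\<close>
  have "finite {x. r *\<^sub>R Poly_Mapping.lookup y x \<noteq> 0}"
    by (rule finite_subset[OF _ finite_lookup[of y]]) auto
  then show ?thesis
    by (simp add: scaleR_poly_mapping_def)
qed

text \<open>\<open>S\<close> lies between the product of the open simplices and the affine space cut
  out by the block sums. Transfers of mass within a block span the directions of both, so the
  boundary points of \<open>S\<close> do not matter. The lemma thus covers the open parameter space
  of a tree as well as the closed set of probability tables.\<close>

lemma affine_dimension_product_of_simplices:
  fixes P :: "'e set set" and S :: "('e \<Rightarrow>\<^sub>0 real) set"
  assumes "finite P" and disj: "disjoint P"
    and fin: "\<And>B. B \<in> P \<Longrightarrow> finite B" and two: "\<And>B. B \<in> P \<Longrightarrow> card B \<ge> 2"
    and hull: "\<And>y. y \<in> S \<Longrightarrow> Poly_Mapping.keys y \<subseteq> \<Union>P \<and> (\<forall>B\<in>P. (\<Sum>x\<in>B. Poly_Mapping.lookup y x) = 1)"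
    and interior: "\<And>y. Poly_Mapping.keys y \<subseteq> \<Union>P \<Longrightarrow> (\<forall>x\<in>\<Union>P. Poly_Mapping.lookup y x \<in> {0<..<1}) \<Longrightarrow>
      (\<forall>B\<in>P. (\<Sum>x\<in>B. Poly_Mapping.lookup y x) = 1) \<Longrightarrow> y \<in> S"
  shows "affine_dimension S = (\<Sum>B\<in>P. card B - 1)"
proof -
  define D where "D = {x - y | x y. x \<in> S \<and> y \<in> S}"
  \<comment> \<open>Each block gets a base point \<open>b B\<close>, whose coordinate is determined
    by the others. The vector \<open>e (B, x)\<close> moves one unit of mass from \<open>b B\<close>
    to \<open>x\<close> and so preserves all block sums; \<open>K\<close> indexes the free
    coordinates.\<close>
  define b where "b B = (SOME x. x \<in> B)" for B :: "'e set"
  define K where "K = (SIGMA B:P. B - {b B})"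
  define e :: "'e set \<times> 'e \<Rightarrow> 'e \<Rightarrow>\<^sub>0 real"
    where "e = (\<lambda>(B, x). Poly_Mapping.single x 1 - Poly_Mapping.single (b B) 1)"
  have finU: "finite (\<Union>P)"
    using \<open>finite P\<close> fin by blast
  have b: "b B \<in> B" if "B \<in> P" for B
    using two[OF that] unfolding b_def by (metis card.empty not_numeral_le_zero some_in_eq)
  have uniq: "B = B'" if "B \<in> P" "B' \<in> P" "x \<in> B" "x \<in> B'" for B B' x
    using disj that by (auto simp: disjoint_def)
  have finK: "finite K"
    unfolding K_def using \<open>finite P\<close> fin by (intro finite_SigmaI) auto
  have cardK: "card K = (\<Sum>B\<in>P. card B - 1)"
    unfolding K_def using \<open>finite P\<close> fin b by (simp add: card_SigmaI)
  \<comment> \<open>Blocks are disjoint and \<open>K\<close> omits base points, so the coordinates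
    named by \<open>K\<close> form a dual system to the vectors \<open>e j\<close>. This yields both
    injectivity and independence.\<close>
  have dual: "Poly_Mapping.lookup (e j) (snd k) = (if j = k then 1 else 0)"
    if "j \<in> K" "k \<in> K" for j k
    using that uniq b
    by (auto simp: K_def e_def lookup_minus lookup_single when_def split: prod.splits)
  have inj: "inj_on e K"
    by (rule inj_onI) (metis dual zero_neq_one)
  have indep: "independent (e ` K)"
  proof (rule independent_if_scalars_zero)
    fix f v
    assume *: "(\<Sum>w\<in>e ` K. f w *\<^sub>R w) = 0" and "v \<in> e ` K"
    then obtain k where k: "k \<in> K" "v = e k"
      by auto
    have "0 = Poly_Mapping.lookup (\<Sum>j\<in>K. f (e j) *\<^sub>R e j) (snd k)"
      using * inj by (simp add: sum.reindex)
    also have "\<dots> = (\<Sum>j\<in>K. if j = k then f (e k) else 0)"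
      unfolding lookup_sum by (rule sum.cong) (auto simp: dual k)
    also have "\<dots> = f v"
      using k finK by simp
    finally show "f v = 0"
      by simp
  qed (use finK in simp)
  have "D \<subseteq> span (e ` K)"
  proof
    fix y
    assume "y \<in> D"
    then obtain s t where st: "s \<in> S" "t \<in> S" "y = s - t"
      unfolding D_def by auto
    then have keys: "Poly_Mapping.keys y \<subseteq> \<Union>P"
      using hull[of s] hull[of t] keys_diff[of s t] by blast
    have sum0: "(\<Sum>x\<in>B. Poly_Mapping.lookup y x) = 0" if "B \<in> P" for B
      using hull[of s] hull[of t] st that by (simp add: lookup_minus sum_subtractf)
    \<comment> \<open>Expand \<open>y\<close> in unit vectors, group them by block, and replace each
      unit vector by its difference from the base vector of its block.\<close>
    have "y = (\<Sum>x\<in>\<Union>P. Poly_Mapping.single x (Poly_Mapping.lookup y x))"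
      using finU keys
      by (intro poly_mapping_eqI) (auto simp: lookup_sum lookup_single when_def in_keys_iff)
    also have "\<dots> = (\<Sum>B\<in>P. \<Sum>x\<in>B. Poly_Mapping.single x (Poly_Mapping.lookup y x))"
      using sum.Union_disjoint[of P] fin uniq by fastforce
    also have "\<dots> = (\<Sum>B\<in>P. \<Sum>x\<in>B - {b B}. Poly_Mapping.lookup y x *\<^sub>R e (B, x))"
    proof (rule sum.cong)
      fix B
      assume B: "B \<in> P"
      have "(\<Sum>x\<in>B - {b B}. Poly_Mapping.lookup y x *\<^sub>R e (B, x)) =
          (\<Sum>x\<in>B. Poly_Mapping.lookup y x *\<^sub>R e (B, x))"
        \<comment> \<open>The index \<open>b B\<close> may be added since
          \<open>e (B, b B) = 0\<close>.\<close>
        by (rule sum.mono_neutral_left) (use fin B in \<open>auto simp: e_def\<close>)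
      also have "\<dots> = (\<Sum>x\<in>B. Poly_Mapping.single x (Poly_Mapping.lookup y x)
          - Poly_Mapping.lookup y x *\<^sub>R Poly_Mapping.single (b B) 1)"
        by (rule sum.cong) (auto simp: e_def scaleR_diff_right intro!: poly_mapping_eqI simp: lookup_minus lookup_single when_def)
      \<comment> \<open>The base vector is subtracted with total coefficient the block sum of
        \<open>y\<close>, which is 0.\<close>
      also have "\<dots> = (\<Sum>x\<in>B. Poly_Mapping.single x (Poly_Mapping.lookup y x))"
        by (simp add: sum_subtractf sum0[OF B] flip: scaleR_sum_left)
      finally show "(\<Sum>x\<in>B. Poly_Mapping.single x (Poly_Mapping.lookup y x)) =
          (\<Sum>x\<in>B - {b B}. Poly_Mapping.lookup y x *\<^sub>R e (B, x))" ..
    qed simp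
    finally have y: "y = (\<Sum>B\<in>P. \<Sum>x\<in>B - {b B}. Poly_Mapping.lookup y x *\<^sub>R e (B, x))" .
    show "y \<in> span (e ` K)"
      by (subst y, intro span_sum span_scale span_base) (auto simp: K_def)
  qed
  \<comment> \<open>Each \<open>e (B, x)\<close> is a multiple of a difference of two interior
    points: the barycentre \<open>u\<close> and its perturbation \<open>v\<close>.\<close>
  have "e ` K \<subseteq> span D"
  proof clarify
    fix B x
    assume "(B, x) \<in> K"
    then have B: "B \<in> P" and x: "x \<in> B" "x \<noteq> b B"
      by (auto simp: K_def)
    \<comment> \<open>The uniform distribution on every block. \<open>THE\<close> picks the only
      block containing \<open>z\<close>; the value 0 elsewhere keeps the support finite.\<close>
    define f where "f z = (if z \<in> \<Union>P then 1 / real (card (THE A. A \<in> P \<and> z \<in> A)) else 0)" for z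
    have f: "f z = 1 / real (card A)" if "A \<in> P" "z \<in> A" for A z
    proof -
      have "(THE A. A \<in> P \<and> z \<in> A) = A"
        using that uniq by (intro the_equality) auto
      then show ?thesis
        using that by (auto simp: f_def)
    qed
    define u where "u = Poly_Mapping.Abs_poly_mapping f"
    have u: "Poly_Mapping.lookup u = f"
      unfolding u_def by (rule lookup_Abs_poly_mapping) (rule finite_subset[OF _ finU], auto simp: f_def)
    \<comment> \<open>Half of the barycentre's coordinate on \<open>B\<close>: the coordinate at
      \<open>b B\<close> is halved and stays positive, and the one at \<open>x\<close> grows by half
      to at most 3/4.\<close>
    define d where "d = 1 / (2 * real (card B))"
    define v where "v = u + d *\<^sub>R e (B, x)"
    have v: "Poly_Mapping.lookup v z = f z + d * ((if z = x then 1 else 0) - (if z = b B then 1 else 0))" for z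
      by (simp add: v_def u e_def lookup_add lookup_minus lookup_single when_def)
    have pos: "1 / real (card A) > 0" "1 / real (card A) \<le> 1 / 2" if "A \<in> P" for A
      using two[OF that] by (auto simp: field_simps)
    have d: "d = 1 / real (card B) / 2" "d > 0"
      using two[OF B] by (auto simp: d_def)
    have sumf: "(\<Sum>z\<in>A. f z) = 1" if "A \<in> P" for A
      using two[OF that] by (simp add: f[OF that])
    have "u \<in> S"
    proof (rule interior)
      show "Poly_Mapping.keys u \<subseteq> \<Union>P"
        by (auto simp: in_keys_iff u f_def split: if_splits)
      show "\<forall>z\<in>\<Union>P. Poly_Mapping.lookup u z \<in> {0<..<1}"
        using pos f by (fastforce simp: u)
    qed (simp add: u sumf)
    moreover have "v \<in> S"
    proof (rule interior)
      show "Poly_Mapping.keys v \<subseteq> \<Union>P"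
        using B x b[OF B] by (auto simp: in_keys_iff v f_def split: if_splits)
      show "\<forall>z\<in>\<Union>P. Poly_Mapping.lookup v z \<in> {0<..<1}"
      proof clarify
        fix z A
        assume A: "A \<in> P" "z \<in> A"
        have "A = B" if "z = x \<or> z = b B"
          using that uniq A B x b by blast
        then show "Poly_Mapping.lookup v z \<in> {0<..<1}"
          using pos[OF A(1)] d x unfolding v f[OF A] by auto
      qed
      show "\<forall>A\<in>P. (\<Sum>z\<in>A. Poly_Mapping.lookup v z) = 1"
      proof
        fix A
        assume A: "A \<in> P"
        \<comment> \<open>A block contains both perturbed coordinates or neither, so the two changes
          cancel in its sum.\<close>
        have "x \<in> A \<longleftrightarrow> b B \<in> A"
          using uniq A B x b by blast
        then show "(\<Sum>z\<in>A. Poly_Mapping.lookup v z) = 1"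
          using fin[OF A] by (simp add: v sum.distrib sumf[OF A] sum_subtractf flip: sum_distrib_left)
      qed
    qed
    ultimately have "v - u \<in> span D"
      unfolding D_def by (intro span_base) blast
    moreover have "e (B, x) = (1 / d) *\<^sub>R (v - u)"
      using d by (simp add: v_def)
    ultimately show "e (B, x) \<in> span D"
      by (simp add: span_scale)
  qed
  then have "dim (span D) = card K"
    using \<open>D \<subseteq> span (e ` K)\<close> indep card_image[OF inj]
    by (intro dim_unique[of "e ` K"]) (auto intro: span_minimal[THEN subsetD])
  then show ?thesis
    by (simp add: affine_dimension_def D_def cardK dim_span)
qed

text \<open>Used for both models: \<open>R\<close> is the block of the class, and \<open>F k\<close>
  holds the blocks of feature \<open>k\<close>. Blocks form a set, so equal blocks would be counted
  once; the last two hypotheses exclude coincidences between levels.\<close>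

lemma sum_card_blocks_by_level:
  fixes p :: nat
  assumes "\<And>k. k \<in> {1..p} \<Longrightarrow> finite (F k)" and "\<And>k. k \<in> {1..p} \<Longrightarrow> card (F k) = m"
    and "\<And>k B. k \<in> {1..p} \<Longrightarrow> B \<in> F k \<Longrightarrow> card B = n k"
    and "\<And>k. k \<in> {1..p} \<Longrightarrow> R \<notin> F k" and "disjoint_family_on F {1..p}"
  shows "(\<Sum>B\<in>insert R (\<Union>k\<in>{1..p}. F k). card B - 1) = card R - 1 + (\<Sum>k = 1..p. m * (n k - 1))"
proof -
  have "(\<Sum>B\<in>(\<Union>k\<in>{1..p}. F k). card B - 1) = (\<Sum>k = 1..p. \<Sum>B\<in>F k. card B - 1)"
    using assms(1,5) by (intro sum.UNION_disjoint) (auto simp: disjoint_family_on_def)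
  also have "\<dots> = (\<Sum>k = 1..p. m * (n k - 1))"
    using assms(2,3) by (intro sum.cong) auto
  finally show ?thesis
    using assms(1,4) by (subst sum.insert) auto
qed

section \<open>Vertices, levels and stages of the classifier tree\<close>

text \<open>\<open>listset\<close> recurses at the front, whereas the tree grows at the end of its
  tuples.\<close>

lemma listset_snoc: "listset (As @ [A]) = {xs @ [x] | xs x. xs \<in> listset As \<and> x \<in> A}"
proof (induction As)
  case Nil
  then show ?case
    by (auto simp: set_Cons_def)
next
  case (Cons A' As)
  show ?case
    unfolding append_Cons listset.simps Cons.IH set_Cons_def
    by (intro set_eqI iffI; clarsimp; metis append_Cons)
qed

lemma feature_tuples_0 [simp]: "feature_tuples X 0 = {[]}"
  by (simp add: feature_tuples_def)

lemma feature_tuples_Suc: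
  "feature_tuples X (Suc i) = {xs @ [x] | xs x. xs \<in> feature_tuples X i \<and> x \<in> X (Suc i)}"
proof -
  have "map X [1..<Suc (Suc i)] = map X [1..<Suc i] @ [X (Suc i)]"
    by simp
  then show ?thesis
    unfolding feature_tuples_def by (simp only: listset_snoc)
qed

lemma length_feature_tuples: "xs \<in> feature_tuples X i \<Longrightarrow> length xs = i"
  by (induction i arbitrary: xs) (auto simp: feature_tuples_Suc)

lemma finite_feature_tuples:
  "(\<And>j. j \<in> {1..i} \<Longrightarrow> finite (X j)) \<Longrightarrow> finite (feature_tuples X i)"
proof (induction i)
  case (Suc i)
  have "feature_tuples X (Suc i) = (\<lambda>(xs, x). xs @ [x]) ` (feature_tuples X i \<times> X (Suc i))"
    by (auto simp: feature_tuples_Suc)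
  moreover have "finite (feature_tuples X i)" "finite (X (Suc i))"
    using Suc by auto
  ultimately show ?case
    by simp
qed simp

lemma edge_from_root_iff: "([], w) \<in> classifier_edges C X p \<longleftrightarrow> (\<exists>c\<in>C. w = [c])"
  by (auto simp: classifier_edges_def)

lemma edge_from_tuple_iff:
  assumes "xs \<in> feature_tuples X i"
  shows "(c # xs, w) \<in> classifier_edges C X p \<longleftrightarrow>
    c \<in> C \<and> i < p \<and> (\<exists>x\<in>X (Suc i). w = c # xs @ [x])"
proof
  assume "(c # xs, w) \<in> classifier_edges C X p"
  then obtain x j where "c \<in> C" "j \<in> {1..p}" "xs \<in> feature_tuples X (j - 1)" "x \<in> X j" "w = c # xs @ [x]"
    by (auto simp: classifier_edges_def)
  \<comment> \<open>The length of \<open>xs\<close> is both \<open>j - 1\<close> and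
    \<open>i\<close>; as \<open>j \<ge> 1\<close>, the subtraction is exact.\<close>
  moreover from this have "j = Suc i"
    using assms by (auto dest!: length_feature_tuples)
  ultimately show "c \<in> C \<and> i < p \<and> (\<exists>x\<in>X (Suc i). w = c # xs @ [x])"
    by auto
next
  assume "c \<in> C \<and> i < p \<and> (\<exists>x\<in>X (Suc i). w = c # xs @ [x])"
  then have "\<exists>x j. w = c # xs @ [x] \<and> c \<in> C \<and> j \<in> {1..p} \<and> xs \<in> feature_tuples X (j - 1) \<and> x \<in> X j"
    using assms by (auto intro!: exI[of _ "Suc i"])
  then show "(c # xs, w) \<in> classifier_edges C X p"
    by (auto simp: classifier_edges_def)
qed

text \<open>The first step of a walk from the root chooses the class and each later step appends one
  feature value, so the distance exceeds the number of features by one.\<close>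

lemma level_Suc_classifier:
  assumes "root_vertex T = []" "vertices T = classifier_vertices C X p"
    "edges T = classifier_edges C X p" and "i \<le> p"
  shows "level T (Suc i) = {c # xs | c xs. c \<in> C \<and> xs \<in> feature_tuples X i}"
proof -
  have "([], v) \<in> classifier_edges C X p ^^ Suc i \<longleftrightarrow>
      (\<exists>c xs. v = c # xs \<and> c \<in> C \<and> xs \<in> feature_tuples X i)" for v
    using \<open>i \<le> p\<close>
  proof (induction i arbitrary: v)
    case 0
    show ?case
      by (auto simp: edge_from_root_iff)
  next
    case (Suc i)
    have "([], v) \<in> classifier_edges C X p ^^ Suc (Suc i) \<longleftrightarrow>
        (\<exists>u. ([], u) \<in> classifier_edges C X p ^^ Suc i \<and> (u, v) \<in> classifier_edges C X p)"
      unfolding relpow.simps(2)[of "Suc i"] by blast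
    also have "\<dots> \<longleftrightarrow> (\<exists>c xs. c \<in> C \<and> xs \<in> feature_tuples X i \<and> (c # xs, v) \<in> classifier_edges C X p)"
      using Suc.IH Suc.prems by (metis Suc_leD)
    also have "\<dots> \<longleftrightarrow> (\<exists>c xs x. c \<in> C \<and> xs \<in> feature_tuples X i \<and> x \<in> X (Suc i) \<and> v = c # xs @ [x])"
      using Suc.prems edge_from_tuple_iff[of _ X i] by (metis Suc_le_eq)
    finally show ?case
      by (auto simp: feature_tuples_Suc)
  qed
  then show ?thesis
    using assms unfolding level_def classifier_vertices_def by auto
qed

text \<open>Being in the same stage is the kernel of the map from a vertex to its label set, so
  classes correspond to values of that map. A class may leave \<open>A\<close>, but it contains its
  representative and therefore determines the label set. This turns naivety into a count of
  blocks.\<close>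

lemma card_quotient_same_stage:
  assumes "A \<subseteq> internal_vertices T"
  shows "card (A // same_stage T) = card ((\<lambda>v. label T ` out_edges T v) ` A)"
proof -
  let ?stage = "\<lambda>B. {w \<in> internal_vertices T. label T ` out_edges T w = B}"
  have "same_stage T `` {v} = ?stage (label T ` out_edges T v)" if "v \<in> A" for v
    using that assms by (auto simp: same_stage_def)
  then have "A // same_stage T = ?stage ` (\<lambda>v. label T ` out_edges T v) ` A"
    unfolding quotient_def image_image by (auto simp del: Image_singleton_iff)
  moreover have "inj_on ?stage ((\<lambda>v. label T ` out_edges T v) ` A)"
  proof (rule inj_onI, clarify)
    fix v w
    assume vw: "v \<in> A" "w \<in> A" and "?stage (label T ` out_edges T v) = ?stage (label T ` out_edges T w)"
    moreover have "v \<in> ?stage (label T ` out_edges T v)"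
      using vw assms by auto
    ultimately have "v \<in> ?stage (label T ` out_edges T w)"
      by simp
    then show "label T ` out_edges T v = label T ` out_edges T w"
      by simp
  qed
  ultimately show ?thesis
    by (simp add: card_image)
qed

section \<open>Free parameters of naive Bayes\<close>

lemma naive_bayes_free_parameters_eq:
  assumes "finite C" "card C \<ge> 2"
    and "\<And>j. j \<in> {1..p} \<Longrightarrow> finite (X j)" "\<And>j. j \<in> {1..p} \<Longrightarrow> card (X j) \<ge> 2"
  shows "naive_bayes_free_parameters C X p = card C - 1 + (\<Sum>j = 1..p. card C * (card (X j) - 1))"
proof -
  \<comment> \<open>The rows of the table of \<open>P(X_k | c)\<close>, one for each class
    value.\<close>
  define F where "F k = (\<lambda>c. Feature_Prob k c ` X k) ` C" for k
  let ?P = "insert (Class_Prob ` C) (\<Union>k\<in>{1..p}. F k)"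
  have inj: "inj Class_Prob" "inj (Feature_Prob k c)" for k and c :: 'a
    by (auto intro: injI)
  have ne: "X k \<noteq> {}" if "k \<in> {1..p}" for k
    using assms(4)[OF that] by auto
  have entries: "naive_bayes_entries C X p = \<Union>?P"
    unfolding naive_bayes_entries_def F_def by blast
  have sums: "(\<forall>B\<in>?P. (\<Sum>e\<in>B. Poly_Mapping.lookup y e) = 1) \<longleftrightarrow>
      (\<Sum>c\<in>C. Poly_Mapping.lookup y (Class_Prob c)) = 1 \<and>
      (\<forall>k\<in>{1..p}. \<forall>c\<in>C. (\<Sum>x\<in>X k. Poly_Mapping.lookup y (Feature_Prob k c x)) = 1)" for y
    using inj by (auto simp: F_def sum.reindex inj_on_subset[OF inj(1)] inj_on_subset[OF inj(2)])
  have "naive_bayes_free_parameters C X p = (\<Sum>B\<in>?P. card B - 1)"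
    unfolding naive_bayes_free_parameters_def
  proof (rule affine_dimension_product_of_simplices)
    show "finite ?P"
      using assms(1) by (auto simp: F_def)
    show "disjoint ?P"
      by (auto simp: F_def disjoint_def)
    show "finite B" if "B \<in> ?P" for B
      using that assms(1,3) by (auto simp: F_def)
    show "2 \<le> card B" if "B \<in> ?P" for B
      using that assms(2,4) by (auto simp: F_def card_image inj_on_subset[OF inj(1)] inj_on_subset[OF inj(2)])
    show "Poly_Mapping.keys y \<subseteq> \<Union>?P \<and> (\<forall>B\<in>?P. (\<Sum>x\<in>B. Poly_Mapping.lookup y x) = 1)"
      if "y \<in> naive_bayes_tables C X p" for y
      using that unfolding naive_bayes_tables_def mem_Collect_eq entries sums by (elim conjE) (intro conjI)
    \<comment> \<open>Tables form the closed product of simplices; strict positivity weakens to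
      nonnegativity.\<close>
    show "y \<in> naive_bayes_tables C X p"
      if "Poly_Mapping.keys y \<subseteq> \<Union>?P" "\<forall>x\<in>\<Union>?P. Poly_Mapping.lookup y x \<in> {0<..<1}"
        "\<forall>B\<in>?P. (\<Sum>x\<in>B. Poly_Mapping.lookup y x) = 1" for y
    proof -
      have "\<forall>x\<in>\<Union>?P. 0 \<le> Poly_Mapping.lookup y x"
        using that(2) by (meson greaterThanLessThan_iff less_imp_le)
      then show ?thesis
        using that(1,3) unfolding naive_bayes_tables_def mem_Collect_eq entries sums
        by (elim conjE) (intro conjI)
    qed
  qed
  also have "\<dots> = card (Class_Prob ` C) - 1 + (\<Sum>k = 1..p. card C * (card (X k) - 1))"
  proof (rule sum_card_blocks_by_level)
    fix k
    assume k: "k \<in> {1..p}"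
    show "finite (F k)"
      using assms(1) by (simp add: F_def)
    \<comment> \<open>A row is nonempty and each of its entries records \<open>c\<close>.\<close>
    have "inj_on (\<lambda>c. Feature_Prob k c ` X k) C"
      using ne[OF k] by (intro inj_onI) blast
    then show "card (F k) = card C"
      by (simp add: F_def card_image)
    show "card B = card (X k)" if "B \<in> F k" for B
      using that by (auto simp: F_def card_image inj_on_subset[OF inj(2)])
    show "Class_Prob ` C \<notin> F k"
      using ne[OF k] by (auto simp: F_def)
  next
    show "disjoint_family_on F {1..p}"
      using ne by (fastforce simp: disjoint_family_on_def F_def)
  qed
  also have "card (Class_Prob ` C) = card C"
    by (simp add: card_image inj_on_subset[OF inj(1)])
  finally show ?thesis .
qed

section \<open>Free parameters of a naive staged tree\<close>

lemma naive_staged_tree_free_parameters_eq: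
  fixes T :: "('a list, 'l \<times> 'a) staged_tree"
  assumes "finite C" "card C \<ge> 2"
    and "\<And>j. j \<in> {1..p} \<Longrightarrow> finite (X j)" "\<And>j. j \<in> {1..p} \<Longrightarrow> card (X j) \<ge> 2"
    and "\<And>j. j \<in> {1..p} \<Longrightarrow> C \<inter> X j = {}" and "disjoint_family_on X {1..p}"
    and "compatible_staged_tree C X p T" and "naive_staged_tree C p T"
  shows "staged_tree_free_parameters T = card C - 1 + (\<Sum>j = 1..p. card C * (card (X j) - 1))"
proof -
  have T: "root_vertex T = []" "vertices T = classifier_vertices C X p" "edges T = classifier_edges C X p"
    using assms(7) by (auto simp: compatible_staged_tree_def)
  obtain \<kappa> :: "'a list \<Rightarrow> 'l"
    where \<kappa>: "\<And>v x. (v, v @ [x]) \<in> edges T \<Longrightarrow> label T (v, v @ [x]) = (\<kappa> v, x)"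
    using assms(7) unfolding compatible_staged_tree_def by blast
  define L where "L v = label T ` out_edges T v" for v
  define F where "F k = L ` level T k" for k
  let ?P = "insert (L []) (\<Union>k\<in>{1..p}. F k)"
  have ne: "X k \<noteq> {}" if "k \<in> {1..p}" for k
    using assms(4)[OF that] by auto
  have level: "\<exists>c xs i. v = c # xs \<and> k = Suc i \<and> i < p \<and> c \<in> C \<and> xs \<in> feature_tuples X i"
    if k: "k \<in> {1..p}" and v: "v \<in> level T k" for k v
  proof -
    from k obtain i where "k = Suc i" "i < p"
      by (cases k) auto
    then show ?thesis
      using v level_Suc_classifier[OF T, of i] by auto
  qed
  \<comment> \<open>The form \<open>[] @ [c]\<close> makes the root an instance of the labelling
    rule for edges \<open>(v, v @ [x])\<close>.\<close>
  have out_root: "out_edges T [] = (\<lambda>c. ([], [] @ [c])) ` C"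
    by (auto simp: out_edges_def T edge_from_root_iff)
  have out: "out_edges T v = (\<lambda>x. (v, v @ [x])) ` X k" if "k \<in> {1..p}" "v \<in> level T k" for k v
    using level[OF that] by (auto simp: out_edges_def T edge_from_tuple_iff)
  have label: "label T (v, v @ [x]) = (\<kappa> v, x)" if "(v, v @ [x]) \<in> out_edges T v" for v x
    using that by (intro \<kappa>) (simp add: out_edges_def)
  have L_root: "L [] = Pair (\<kappa> []) ` C"
    unfolding L_def out_root image_image by (rule image_cong[OF refl], rule label) (simp add: out_root)
  have L: "L v = Pair (\<kappa> v) ` X k" if "k \<in> {1..p}" "v \<in> level T k" for k v
    unfolding L_def out[OF that] image_image by (rule image_cong[OF refl], rule label) (simp add: out[OF that])
  \<comment> \<open>A block remembers its sample space; this later separates blocks of different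
    levels and the root block.\<close>
  have snd_F: "snd ` B = X k" if "k \<in> {1..p}" "B \<in> F k" for k B
    using that by (auto simp: F_def L image_image)
  have internal: "internal_vertices T = insert [] (\<Union>k\<in>{1..p}. level T k)"
  proof (intro equalityI subsetI)
    fix v
    assume v: "v \<in> internal_vertices T"
    show "v \<in> insert [] (\<Union>k\<in>{1..p}. level T k)"
    proof (cases v)
      case (Cons c xs)
      then obtain i where i: "c \<in> C" "i \<le> p" "xs \<in> feature_tuples X i"
        using v by (auto simp: internal_vertices_def T classifier_vertices_def)
      \<comment> \<open>A tuple with all \<open>p\<close> features is a leaf and has no outgoing
        edge.\<close>
      then have "i < p"
        using v Cons by (auto simp: internal_vertices_def out_edges_def T edge_from_tuple_iff)
      moreover have "v \<in> level T (Suc i)"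
        using i Cons level_Suc_classifier[OF T, of i] by auto
      ultimately show ?thesis
        by auto
    qed simp
  next
    fix v
    assume "v \<in> insert [] (\<Union>k\<in>{1..p}. level T k)"
    then consider "v = []" | k where "k \<in> {1..p}" "v \<in> level T k"
      by auto
    then show "v \<in> internal_vertices T"
    proof cases
      case 1
      then show ?thesis
        using assms(2) by (auto simp: internal_vertices_def out_root T classifier_vertices_def)
    next
      case 2
      then show ?thesis
        using ne out by (auto simp: internal_vertices_def level_def)
    qed
  qed
  \<comment> \<open>One block per stage: vertices in the same stage have the same label set.\<close>
  have P: "?P = L ` internal_vertices T"
    unfolding internal F_def by auto
  have "\<exists>v\<in>internal_vertices T. e \<in> out_edges T v" if "e \<in> edges T" for e
  proof
    have e: "e \<in> out_edges T (fst e)"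
      using that by (simp add: out_edges_def)
    moreover have "fst e \<in> vertices T"
      using that by (force simp: T classifier_edges_def classifier_vertices_def)
    ultimately show "fst e \<in> internal_vertices T"
      by (auto simp: internal_vertices_def)
    show "e \<in> out_edges T (fst e)" by (fact e)
  qed
  then have edges: "edges T = (\<Union>v\<in>internal_vertices T. out_edges T v)"
    by (auto simp: out_edges_def)
  have labels: "label T ` edges T = \<Union>?P"
    unfolding P edges by (auto simp: L_def)
  \<comment> \<open>Edges leaving one vertex share its colour and differ in the value, so sums over
    edges become sums over labels.\<close>
  have inj: "inj_on (label T) (out_edges T v)" if "v \<in> internal_vertices T" for v
  proof -
    have "\<exists>A. out_edges T v = (\<lambda>x. (v, v @ [x])) ` A"
      using that out_root out unfolding internal by blast
    then show ?thesis
      using label by (fastforce intro: inj_onI)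
  qed
  have "(\<Sum>l\<in>L v. Poly_Mapping.lookup y l) = (\<Sum>e\<in>out_edges T v. Poly_Mapping.lookup y (label T e))"
    if "v \<in> internal_vertices T" for y :: "'l \<times> 'a \<Rightarrow>\<^sub>0 real" and v
    unfolding L_def by (simp add: sum.reindex[OF inj[OF that]])
  \<comment> \<open>The parameter space is exactly the product of the open simplices over the
    blocks.\<close>
  then have space: "parameter_space T = {y. Poly_Mapping.keys y \<subseteq> \<Union>?P \<and>
      (\<forall>l\<in>\<Union>?P. Poly_Mapping.lookup y l \<in> {0<..<1}) \<and> (\<forall>B\<in>?P. (\<Sum>l\<in>B. Poly_Mapping.lookup y l) = 1)}"
    unfolding parameter_space_def labels[symmetric] unfolding P by auto
  have fin_level: "finite (level T k)" if "k \<in> {1..p}" for k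
  proof -
    have "level T k = (\<lambda>(c, xs). c # xs) ` (C \<times> feature_tuples X (k - 1))"
      using level_Suc_classifier[OF T, of "k - 1"] that by auto
    moreover have "finite (feature_tuples X (k - 1))"
      using that assms(3) by (intro finite_feature_tuples) auto
    ultimately show ?thesis
      using assms(1) by simp
  qed
  have "staged_tree_free_parameters T = (\<Sum>B\<in>?P. card B - 1)"
    unfolding staged_tree_free_parameters_def
  proof (rule affine_dimension_product_of_simplices)
    show "finite ?P"
      using fin_level by (auto simp: F_def)
    show "disjoint ?P"
    proof -
      \<comment> \<open>A shared label fixes the level, since its value lies in only one
        \<open>X k\<close>, and fixes the colour; these two determine the whole block.\<close>
      have "L v = L w" if kj: "k \<in> {1..p}" "j \<in> {1..p}" and vw: "v \<in> level T k" "w \<in> level T j"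
        and l: "l \<in> L v" "l \<in> L w" for k j v w l
      proof -
        have "snd l \<in> X k \<inter> X j" "\<kappa> v = \<kappa> w"
          using l L kj vw by auto
        moreover from this have "k = j"
          using assms(6) kj unfolding disjoint_family_on_def by blast
        ultimately show ?thesis
          using L kj vw by simp
      qed
      moreover have "L [] \<inter> L v = {}" if "k \<in> {1..p}" "v \<in> level T k" for k v
        using assms(5)[OF that(1)] unfolding L[OF that] L_root by auto
      ultimately show ?thesis
        unfolding disjoint_def F_def by (simp only: Ball_def) blast
    qed
    show "finite B" if "B \<in> ?P" for B
      using that assms(1,3) by (auto simp: F_def L L_root)
    show "2 \<le> card B" if "B \<in> ?P" for B
      using that assms(2,4) by (auto simp: F_def L L_root card_image inj_on_def)
  qed (auto simp only: space mem_Collect_eq)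
  also have "\<dots> = card (L []) - 1 + (\<Sum>k = 1..p. card C * (card (X k) - 1))"
  proof (rule sum_card_blocks_by_level)
    fix k
    assume k: "k \<in> {1..p}"
    show "finite (F k)"
      using fin_level[OF k] by (simp add: F_def)
    have "level T k \<subseteq> internal_vertices T"
      using k by (auto simp: internal)
    \<comment> \<open>Naivety enters here: the blocks of level \<open>k\<close> are as many as its
      stages.\<close>
    then show "card (F k) = card C"
      using card_quotient_same_stage[of "level T k" T] assms(8) k
      by (simp add: F_def L_def naive_staged_tree_def)
    show "card B = card (X k)" if "B \<in> F k" for B
      using that k by (auto simp: F_def L card_image inj_on_def)
    show "L [] \<notin> F k"
    proof
      assume "L [] \<in> F k"
      \<comment> \<open>Equal blocks have equal sets of values, but \<open>C\<close> and
        \<open>X k\<close> are disjoint and \<open>C\<close> is nonempty.\<close>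
      then have "C = X k"
        using snd_F[OF k] by (force simp: L_root image_image)
      then have "C = {}"
        using assms(5)[OF k] by blast
      then show False
        using assms(2) by simp
    qed
  next
    show "disjoint_family_on F {1..p}"
      unfolding disjoint_family_on_def
    proof (intro ballI impI)
      fix k j
      assume kj: "k \<in> {1..p}" "j \<in> {1..p}" "k \<noteq> j"
      have "X k \<inter> X j = {}"
        using assms(6) kj by (auto simp: disjoint_family_on_def)
      \<comment> \<open>A common block would force \<open>X k = X j\<close>, and disjointness would
        make this set empty.\<close>
      then show "F k \<inter> F j = {}"
        using kj ne[of k] snd_F by (metis Int_absorb disjoint_iff)
    qed
  qed
  also have "card (L []) = card C"
    by (simp add: L_root card_image inj_on_def)
  finally show ?thesis .
qed

theorem mainTheorem1:
  fixes C :: "'a set" and X :: "nat \<Rightarrow> 'a set" and p :: nat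
    and T :: "('a list, 'l \<times> 'a) staged_tree"
  assumes "p \<ge> 1"
    and "finite C" and "card C \<ge> 2"
    and "\<And>j. j \<in> {1..p} \<Longrightarrow> finite (X j)" and "\<And>j. j \<in> {1..p} \<Longrightarrow> card (X j) \<ge> 2"
    and "\<And>j. j \<in> {1..p} \<Longrightarrow> C \<inter> X j = {}" and "disjoint_family_on X {1..p}"
    and "compatible_staged_tree C X p T"
    and "naive_staged_tree C p T"
  shows "staged_tree_free_parameters T = naive_bayes_free_parameters C X p \<and>
    naive_bayes_free_parameters C X p = card C - 1 + (\<Sum>j = 1..p. card C * (card (X j) - 1))"
  using naive_staged_tree_free_parameters_eq[OF assms(2-9)] naive_bayes_free_parameters_eq[OF assms(2-5)]
  by simp

end
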